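(* Let $f:[0,1]\to[0,1]$ be a continuous map without wandering intervals. Then there exists a residual subset $G\subset[0,1]$ such that for any $x\in G$ one of the following possibilities holds: 1) $\omega(x)$ is a cycle; 2) $\omega(x)$ is a solenoid; 3) $\omega(x)=\mathrm{orb}\,I$ is a cycle of intervals.
   Context: $\omega(x)$ is the set of limit points of the forward orbit of $x$. A cycle is the orbit of a periodic point. A (non-degenerate) interval $I$ is wandering if $f^nI\cap f^mI=\emptyset$ for all $n>m\ge0$ and $I$ does not tend to a cycle (i.e. the limit set of the points of $I$ is not a cycle). A closed interval $I$ is periodic of period $k$ if $I,fI,\dots,f^{k-1}I$ are pairwise disjoint and $f^kI=I$; then $\mathrm{orb}\,I=\bigcup_{i=0}^{k-1}f^iI$ is called a cycle of intervals. If $I_0\supset I_1\supset\cdots$ are periodic intervals with periods tending to infinity and $Q=\bigcap_j\mathrm{orb}\,I_j$ is nowhere dense, then $Q$ is called a solenoid. A set is residual if it contains a dense $G_\delta$-set. *)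

theory Defs
  imports "HOL-Analysis.Analysis"
begin

text \<open>
  A map f : [0,1] \<rightarrow> [0,1] is represented by a function on the reals; all notions below
  depend only on its restriction to the unit interval (for points and sets inside it).
\<close>

abbreviation unit_space :: "real topology" where
  "unit_space \<equiv> top_of_set {0..1}"

definition nowhere_dense_in :: "'a topology \<Rightarrow> 'a set \<Rightarrow> bool" where
  "nowhere_dense_in X S \<longleftrightarrow> S \<subseteq> topspace X \<and> X interior_of (X closure_of S) = {}"

definition residual_in :: "'a topology \<Rightarrow> 'a set \<Rightarrow> bool" where
  "residual_in X S \<longleftrightarrow> S \<subseteq> topspace X \<and>
     (\<exists>D \<subseteq> S. gdelta_in X D \<and> X closure_of D = topspace X)"

text \<open>
  Limit points are those of the sequence of iterates, not accumulation points of the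
  set of its values, so that a periodic point has its own orbit as limit set.
\<close>

definition omega_limit :: "(real \<Rightarrow> real) \<Rightarrow> real \<Rightarrow> real set" where
  "omega_limit f x =
     {y. \<exists>r :: nat \<Rightarrow> nat. strict_mono r \<and> (\<lambda>n. (f ^^ r n) x) \<longlonglongrightarrow> y}"

definition point_cycle :: "(real \<Rightarrow> real) \<Rightarrow> real set \<Rightarrow> bool" where
  "point_cycle f C \<longleftrightarrow>
     (\<exists>p\<in>{0..1}. (\<exists>k>0. (f ^^ k) p = p) \<and> C = range (\<lambda>n. (f ^^ n) p))"

definition tends_to_cycle :: "(real \<Rightarrow> real) \<Rightarrow> real set \<Rightarrow> bool" where
  "tends_to_cycle f I \<longleftrightarrow> (\<exists>C. point_cycle f C \<and> (\<forall>x\<in>I. omega_limit f x = C))"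

text \<open>
  A wandering interval need be neither open nor closed, and its images may be degenerate.
\<close>

definition wandering_interval :: "(real \<Rightarrow> real) \<Rightarrow> real set \<Rightarrow> bool" where
  "wandering_interval f I \<longleftrightarrow>
     I \<subseteq> {0..1} \<and> is_interval I \<and> (\<exists>a\<in>I. \<exists>b\<in>I. a < b) \<and>
     (\<forall>n m. m < n \<longrightarrow> (f ^^ n) ` I \<inter> (f ^^ m) ` I = {}) \<and>
     \<not> tends_to_cycle f I"

text \<open>
  Periodic intervals are non-degenerate; hence a cycle of intervals is never
  just a cycle of points.
\<close>

definition periodic_interval :: "(real \<Rightarrow> real) \<Rightarrow> real set \<Rightarrow> nat \<Rightarrow> bool" where
  "periodic_interval f I k \<longleftrightarrow>
     (\<exists>a b. 0 \<le> a \<and> a < b \<and> b \<le> 1 \<and> I = {a..b}) \<and> 0 < k \<and>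
     (\<forall>i<k. \<forall>j<k. i \<noteq> j \<longrightarrow> (f ^^ i) ` I \<inter> (f ^^ j) ` I = {}) \<and>
     (f ^^ k) ` I = I"

definition interval_orbit :: "(real \<Rightarrow> real) \<Rightarrow> real set \<Rightarrow> nat \<Rightarrow> real set" where
  "interval_orbit f I k = (\<Union>i<k. (f ^^ i) ` I)"

definition cycle_of_intervals :: "(real \<Rightarrow> real) \<Rightarrow> real set \<Rightarrow> bool" where
  "cycle_of_intervals f M \<longleftrightarrow>
     (\<exists>I k. periodic_interval f I k \<and> M = interval_orbit f I k)"

definition solenoid :: "(real \<Rightarrow> real) \<Rightarrow> real set \<Rightarrow> bool" where
  "solenoid f Q \<longleftrightarrow>
     (\<exists>(I :: nat \<Rightarrow> real set) (p :: nat \<Rightarrow> nat).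
        (\<forall>j. periodic_interval f (I j) (p j)) \<and>
        (\<forall>j. I (Suc j) \<subseteq> I j) \<and>
        filterlim p at_top sequentially \<and>
        Q = (\<Inter>j. interval_orbit f (I j) (p j)) \<and>
        nowhere_dense_in unit_space Q)"

end

theory Submission
  imports Defs
begin

text \<open>
  For a set V let limit_set f V be the intersection over N of the closures of the unions of
  the images of V under the iterates of order at least N. A Baire argument over a countable
  base shows that for generic x the set omega(x) is the intersection of limit_set f V over
  all neighbourhoods V of x. If some interval V around x has pairwise disjoint images, it
  must tend to a cycle, as it does not wander. Otherwise two images of every V meet, which
  makes limit_set f V a finite cycle of closed intervals (possibly points), and omega(x) is a
  nested intersection of such cycles. If their periods stay bounded, this is a cycle or a
  cycle of intervals. If the periods are unbounded it is a solenoid: it is nowhere dense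
  because any interval in it would wander.
\<close>

section \<open>Decreasing intersections and connected chains\<close>

lemma UN_atLeast_subset_mono: "N \<le> M \<Longrightarrow> (\<Union>n\<in>{M::nat..}. A n) \<subseteq> (\<Union>n\<in>{N..}. A n)"
  by (intro UN_mono) auto

text \<open>A point outside the right-hand side leaves each \<open>D i\<close> at some stage
  \<open>m i\<close>; as \<open>I\<close> is finite and the sets decrease, one stage beyond all
  \<open>m i\<close> excludes it for every \<open>i\<close> at once.\<close>

lemma INT_finite_UN_decseq:
  fixes D :: "'a \<Rightarrow> nat \<Rightarrow> 'b set"
  assumes "finite I" and dec: "\<And>i M N. i \<in> I \<Longrightarrow> M \<le> N \<Longrightarrow> D i N \<subseteq> D i M"
  shows "(\<Inter>M. \<Union>i\<in>I. D i M) = (\<Union>i\<in>I. \<Inter>M. D i M)"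
proof
  show "(\<Inter>M. \<Union>i\<in>I. D i M) \<subseteq> (\<Union>i\<in>I. \<Inter>M. D i M)"
  proof (rule subsetI, rule ccontr)
    fix y
    assume y: "y \<in> (\<Inter>M. \<Union>i\<in>I. D i M)" and "y \<notin> (\<Union>i\<in>I. \<Inter>M. D i M)"
    then have "\<forall>i\<in>I. \<exists>M. y \<notin> D i M" by blast
    then obtain m where m: "\<And>i. i \<in> I \<Longrightarrow> y \<notin> D i (m i)" by metis
    obtain K where K: "\<And>i. i \<in> I \<Longrightarrow> m i \<le> K"
      using finite_imageI[OF \<open>finite I\<close>, of m] by (meson finite_nat_set_iff_bounded_le imageI)
    from y obtain i where "i \<in> I" "y \<in> D i K" by blast
    with dec[of i "m i" K] K m show False by blast
  qed
qed blast

text \<open>Over a point \<open>y\<close> of the right-hand side, the fibres of \<open>g\<close> in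
  the sets \<open>C j\<close> are nested, non-empty and compact, so they share a point.\<close>

lemma image_INT_compact_decseq:
  fixes C :: "nat \<Rightarrow> real set" and g :: "real \<Rightarrow> real"
  assumes "\<And>j. compact (C j)" and dec: "\<And>i j. i \<le> j \<Longrightarrow> C j \<subseteq> C i"
    and g: "continuous_on (C 0) g"
  shows "g ` (\<Inter>j. C j) = (\<Inter>j. g ` C j)"
proof
  show "(\<Inter>j. g ` C j) \<subseteq> g ` (\<Inter>j. C j)"
  proof
    fix y assume y: "y \<in> (\<Inter>j. g ` C j)"
    define F where "F j = C j \<inter> g -` {y}" for j
    have "compact (F j)" for j
    proof -
      have "continuous_on (C j) g"
        using continuous_on_subset[OF g dec[of 0 j]] by simp
      then have "closed (F j)"
        unfolding F_def using continuous_closed_preimage[of "C j" g "{y}"] compact_imp_closed[OF assms(1)[of j]]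
        by blast
      then show ?thesis
        unfolding F_def using assms(1)[of j] by (metis compact_Int_closed inf.absorb_iff2 inf_le1)
    qed
    moreover have "F j \<noteq> {}" for j
      using y unfolding F_def by blast
    moreover have "F j \<subseteq> F i" if "i \<le> j" for i j
      unfolding F_def using dec[OF that] by blast
    ultimately have "\<Inter>(range F) \<noteq> {}" by (rule compact_nest)
    then show "y \<in> g ` (\<Inter>j. C j)" unfolding F_def by blast
  qed
qed blast

text \<open>Finite partial unions are connected by induction, each new set meeting its predecessor,
  and all of them contain a common point of \<open>A 0\<close>.\<close>

lemma connected_UN_chain:
  fixes A :: "nat \<Rightarrow> 'a::topological_space set"
  assumes conn: "\<And>n. connected (A n)" and meet: "\<And>n. A n \<inter> A (Suc n) \<noteq> {}"
  shows "connected (\<Union>n. A n)"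
proof -
  have *: "connected (\<Union>i\<le>n. A i)" for n
  proof (induction n)
    case (Suc n)
    have "(\<Union>i\<le>n. A i) \<inter> A (Suc n) \<noteq> {}" using meet[of n] by blast
    then have "connected ((\<Union>i\<le>n. A i) \<union> A (Suc n))"
      using Suc conn by (intro connected_Un) auto
    then show ?case by (simp add: atMost_Suc Un_commute)
  qed (simp add: conn)
  obtain a where "a \<in> A 0" using meet[of 0] by blast
  have "connected (\<Union>(range (\<lambda>n. \<Union>i\<le>n. A i)))"
  proof (rule connected_Union)
    show "\<Inter>(range (\<lambda>n. \<Union>i\<le>n. A i)) \<noteq> {}" using \<open>a \<in> A 0\<close> by blast
  qed (use * in blast)
  moreover have "\<Union>(range (\<lambda>n. \<Union>i\<le>n. A i)) = (\<Union>n. A n)" by blast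
  ultimately show ?thesis by simp
qed

lemma compact_connected_real_interval:
  fixes S :: "real set"
  assumes "compact S" "connected S" "S \<noteq> {}"
  obtains a b where "a \<le> b" "S = {a..b}"
proof -
  obtain a b where S: "S = {a..b}"
    using assms(1,2) connected_compact_interval_1[of S] by (auto simp: cbox_interval)
  with assms(3) have "a \<le> b" by simp
  then show thesis using S that by blast
qed

section \<open>Images under iterates, orbits of sets and cycles of disjoint intervals\<close>

lemma image_funpow_add: "(f ^^ (m + n)) ` S = (f ^^ m) ` (f ^^ n) ` S"
  by (simp add: funpow_add image_comp)

lemma image_funpow_mult:
  assumes "(f ^^ p) ` J = J"
  shows "(f ^^ (p * r)) ` J = J"
proof (induction r)
  case (Suc r)
  then show ?case by (simp only: mult_Suc_right image_funpow_add assms)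
qed simp

lemma image_funpow_mod:
  assumes "(f ^^ p) ` J = J"
  shows "(f ^^ n) ` J = (f ^^ (n mod p)) ` J"
proof -
  have "(f ^^ n) ` J = (f ^^ (n mod p + p * (n div p))) ` J" by simp
  then show ?thesis by (simp only: image_funpow_add image_funpow_mult[OF assms])
qed

text \<open>The union runs over all times instead of one period, so it keeps its form when a period
  is replaced by a smaller one.\<close>

definition orbit_set :: "('a \<Rightarrow> 'a) \<Rightarrow> 'a set \<Rightarrow> 'a set" where
  "orbit_set f J = (\<Union>n. (f ^^ n) ` J)"

lemma orbit_set_periodic:
  assumes "(f ^^ p) ` J = J" "0 < p"
  shows "orbit_set f J = (\<Union>i<p. (f ^^ i) ` J)"
proof
  show "orbit_set f J \<subseteq> (\<Union>i<p. (f ^^ i) ` J)"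
    unfolding orbit_set_def
  proof (rule UN_least)
    fix n
    have "n mod p < p" using assms(2) by simp
    then show "(f ^^ n) ` J \<subseteq> (\<Union>i<p. (f ^^ i) ` J)"
      using image_funpow_mod[OF assms(1), of n] by blast
  qed
qed (auto simp: orbit_set_def)

lemma orbit_set_shift:
  assumes "(f ^^ p) ` J = J" "0 < p"
  shows "orbit_set f ((f ^^ m) ` J) = orbit_set f J"
proof
  show "orbit_set f ((f ^^ m) ` J) \<subseteq> orbit_set f J"
    unfolding orbit_set_def image_funpow_add[symmetric] by blast
  show "orbit_set f J \<subseteq> orbit_set f ((f ^^ m) ` J)"
    unfolding orbit_set_def
  proof (rule UN_least)
    fix n
    \<comment> \<open>\<open>p * m\<close> is a multiple of the period that is at least
      \<open>m\<close>, so waiting that long leaves room to pass through the image at time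
      \<open>m\<close>.\<close>
    have "1 * m \<le> p * m" using assms(2) by (intro mult_le_mono1) simp
    then have "n + p * m = (n + p * m - m) + m" by linarith
    then have "(f ^^ n) ` (f ^^ (p * m)) ` J = (f ^^ (n + p * m - m)) ` (f ^^ m) ` J"
      by (simp only: image_funpow_add[symmetric])
    then have "(f ^^ n) ` J = (f ^^ (n + p * m - m)) ` (f ^^ m) ` J"
      by (simp only: image_funpow_mult[OF assms(1)])
    then show "(f ^^ n) ` J \<subseteq> (\<Union>n. (f ^^ n) ` (f ^^ m) ` J)" by blast
  qed
qed

text \<open>Unlike \<^const>\<open>periodic_interval\<close>, the interval may be a single point.\<close>

definition disjoint_cycle :: "(real \<Rightarrow> real) \<Rightarrow> real set \<Rightarrow> nat \<Rightarrow> bool" where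
  "disjoint_cycle f J p \<longleftrightarrow>
     compact J \<and> connected J \<and> J \<noteq> {} \<and> J \<subseteq> {0..1} \<and> 0 < p \<and> (f ^^ p) ` J = J \<and>
     (\<forall>i<p. \<forall>j<p. i \<noteq> j \<longrightarrow> (f ^^ i) ` J \<inter> (f ^^ j) ` J = {})"

lemma disjoint_cycleD:
  assumes "disjoint_cycle f J p"
  shows "compact J" "connected J" "J \<noteq> {}" "J \<subseteq> {0..1}" "0 < p" "(f ^^ p) ` J = J"
  using assms unfolding disjoint_cycle_def by simp_all

text \<open>Images depend only on the exponent modulo \<open>p\<close>, and the first
  \<open>p\<close> of them are non-empty and disjoint. Questions about meeting images thus become
  congruences, which is how periods are compared later.\<close>

lemma disjoint_cycle_meet_iff:
  assumes "disjoint_cycle f J p"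
  shows "(f ^^ m) ` J \<inter> (f ^^ n) ` J \<noteq> {} \<longleftrightarrow> m mod p = n mod p"
proof -
  have *: "(f ^^ m) ` J = (f ^^ (m mod p)) ` J" "(f ^^ n) ` J = (f ^^ (n mod p)) ` J"
    using assms unfolding disjoint_cycle_def by (simp_all add: image_funpow_mod[symmetric])
  have "m mod p < p" "n mod p < p" "J \<noteq> {}"
    using assms unfolding disjoint_cycle_def by auto
  moreover have "(f ^^ (m mod p)) ` J \<inter> (f ^^ (n mod p)) ` J = {}" if "m mod p \<noteq> n mod p"
    using assms that \<open>m mod p < p\<close> \<open>n mod p < p\<close> unfolding disjoint_cycle_def by blast
  ultimately show ?thesis
    unfolding * by (cases "m mod p = n mod p") simp_all
qed

lemma disjoint_cycle_orbit_set:
  "disjoint_cycle f J p \<Longrightarrow> orbit_set f J = (\<Union>i<p. (f ^^ i) ` J)"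
  by (rule orbit_set_periodic) (auto dest: disjoint_cycleD)

lemma disjoint_cycle_interval_orbit:
  "disjoint_cycle f J p \<Longrightarrow> interval_orbit f J p = orbit_set f J"
  by (simp add: disjoint_cycle_orbit_set interval_orbit_def)

lemma disjoint_cycle_nondegenerate:
  assumes "disjoint_cycle f J p" "\<nexists>q. J = {q}"
  shows "periodic_interval f J p"
proof -
  obtain a b where ab: "a \<le> b" "J = {a..b}"
    using disjoint_cycleD[OF assms(1)] by (metis compact_connected_real_interval)
  with assms(2) have "a < b" by (metis order_le_less atLeastAtMost_singleton)
  moreover have "0 \<le> a" "b \<le> 1"
    using ab assms(1) unfolding disjoint_cycle_def by auto
  ultimately show ?thesis
    using assms(1) ab unfolding disjoint_cycle_def periodic_interval_def by blast
qed

section \<open>Limit sets of sets and of points\<close>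

text \<open>A limit point may be approached by iterates of varying points of \<open>V\<close>, so
  this set can exceed the union of the omega-limit sets of the points of \<open>V\<close>.\<close>

definition limit_set :: "(real \<Rightarrow> real) \<Rightarrow> real set \<Rightarrow> real set" where
  "limit_set f V = (\<Inter>N. closure (\<Union>n\<in>{N..}. (f ^^ n) ` V))"

lemma limit_set_mono: "U \<subseteq> V \<Longrightarrow> limit_set f U \<subseteq> limit_set f V"
  unfolding limit_set_def by (intro INF_mono' closure_mono UN_mono image_mono) auto

text \<open>Lying in the closure of every tail means that the orbit comes arbitrarily close at
  arbitrarily late times; lateness lets the chosen times increase strictly even when the values
  repeat.\<close>

lemma omega_limit_eq_limit_set: "omega_limit f x = limit_set f {x}"
proof (intro subset_antisym subsetI)
  fix y assume "y \<in> omega_limit f x"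
  then obtain r :: "nat \<Rightarrow> nat" where r: "strict_mono r" "(\<lambda>n. (f ^^ r n) x) \<longlonglongrightarrow> y"
    unfolding omega_limit_def by blast
  have "y \<in> closure (\<Union>n\<in>{N..}. (f ^^ n) ` {x})" for N
  proof (rule Lim_in_closed_set[OF closed_closure _ _ r(2)])
    have "(f ^^ r n) x \<in> (\<Union>n\<in>{N..}. (f ^^ n) ` {x})" if "N \<le> n" for n
      using seq_suble[OF r(1), of n] that by auto
    then show "\<forall>\<^sub>F n in sequentially. (f ^^ r n) x \<in> closure (\<Union>n\<in>{N..}. (f ^^ n) ` {x})"
      using closure_subset by (fastforce intro: eventually_sequentiallyI[of N])
  qed simp
  then show "y \<in> limit_set f {x}" unfolding limit_set_def by blast
next
  fix y assume y: "y \<in> limit_set f {x}"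
  have *: "\<exists>n\<ge>N. dist ((f ^^ n) x) y < e" if "0 < e" for N e
  proof -
    have "y \<in> closure (\<Union>n\<in>{N..}. (f ^^ n) ` {x})" using y unfolding limit_set_def by blast
    with that obtain z where "z \<in> (\<Union>n\<in>{N..}. (f ^^ n) ` {x})" "dist z y < e"
      unfolding closure_approachable by blast
    then show ?thesis by auto
  qed
  have "\<exists>r. \<forall>n. dist ((f ^^ r n) x) y < inverse (real (Suc n)) \<and> r n < r (Suc n)"
  proof (rule dependent_nat_choice)
    show "\<exists>m. dist ((f ^^ m) x) y < inverse (real (Suc 0))"
      using *[of "inverse (real (Suc 0))" 0] by auto
    show "\<exists>m'. dist ((f ^^ m') x) y < inverse (real (Suc (Suc n))) \<and> m < m'" for m n
      using *[of "inverse (real (Suc (Suc n)))" "Suc m"] by (auto simp: Suc_le_eq)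
  qed
  then obtain r where r: "\<And>n. dist ((f ^^ r n) x) y < inverse (real (Suc n))" "\<And>n. r n < r (Suc n)"
    by blast
  have "(\<lambda>n. dist ((f ^^ r n) x) y) \<longlonglongrightarrow> 0"
    by (rule tendsto_sandwich[OF _ _ tendsto_const LIMSEQ_inverse_real_of_nat])
      (use less_imp_le[OF r(1)] in \<open>simp_all del: of_nat_Suc\<close>)
  then have "(\<lambda>n. (f ^^ r n) x) \<longlonglongrightarrow> y" by (simp add: tendsto_dist_iff[of _ y])
  moreover have "strict_mono r" using r(2) by (simp add: strict_mono_Suc_iff)
  ultimately show "y \<in> omega_limit f x" unfolding omega_limit_def by blast
qed

section \<open>Iterates of the interval map and reduction to disjoint cycles\<close>

context
  fixes f :: "real \<Rightarrow> real"
  assumes cont: "continuous_on {0..1} f" and maps: "f ` {0..1} \<subseteq> {0..1}"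
begin

lemma funpow_maps: "S \<subseteq> {0..1} \<Longrightarrow> (f ^^ n) ` S \<subseteq> {0..1}"
proof (induction n)
  case (Suc n)
  then have "f ` (f ^^ n) ` S \<subseteq> f ` {0..1}" by (intro image_mono) simp
  with maps show ?case by (simp add: image_comp)
qed simp

lemma funpow_cont: "continuous_on {0..1} (f ^^ n)"
proof (induction n)
  case (Suc n)
  have "continuous_on ((f ^^ n) ` {0..1}) f"
    using continuous_on_subset[OF cont] funpow_maps by simp
  with Suc show ?case using continuous_on_compose[of "{0..1}" "f ^^ n" f] by (simp add: o_def)
qed simp

lemma funpow_compact: "compact S \<Longrightarrow> S \<subseteq> {0..1} \<Longrightarrow> compact ((f ^^ n) ` S)"
  by (rule compact_continuous_image) (rule continuous_on_subset[OF funpow_cont])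

lemma funpow_connected: "connected S \<Longrightarrow> S \<subseteq> {0..1} \<Longrightarrow> connected ((f ^^ n) ` S)"
  by (rule connected_continuous_image) (rule continuous_on_subset[OF funpow_cont])

lemma disjoint_cycle_shift:
  assumes "disjoint_cycle f J p"
  shows "disjoint_cycle f ((f ^^ n) ` J) p"
proof -
  note J = disjoint_cycleD[OF assms]
  have "(f ^^ i) ` (f ^^ n) ` J \<inter> (f ^^ j) ` (f ^^ n) ` J = {}" if "i < p" "j < p" "i \<noteq> j" for i j
  proof -
    have "(i + n) mod p \<noteq> (j + n) mod p"
    proof
      assume "(i + n) mod p = (j + n) mod p"
      \<comment> \<open>Adding \<open>p * n - n\<close> completes the shift by \<open>n\<close> to a
        shift by \<open>p * n\<close>, which vanishes modulo \<open>p\<close>.\<close>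
      then have "(i + n + (p * n - n)) mod p = (j + n + (p * n - n)) mod p"
        by (rule mod_add_cong) simp
      moreover have "n \<le> p * n" using J(5) by simp
      ultimately have "(i + p * n) mod p = (j + p * n) mod p" by simp
      with that show False by simp
    qed
    then have "\<not> (f ^^ (i + n)) ` J \<inter> (f ^^ (j + n)) ` J \<noteq> {}"
      using disjoint_cycle_meet_iff[OF assms, of "i + n" "j + n"] by blast
    then show ?thesis by (simp only: image_funpow_add not_not)
  qed
  moreover have "(f ^^ p) ` (f ^^ n) ` J = (f ^^ n) ` J"
    by (simp only: image_funpow_add[symmetric] add.commute[of p n]) (simp only: image_funpow_add J(6))
  ultimately show ?thesis
    unfolding disjoint_cycle_def
    using J funpow_compact funpow_connected funpow_maps by simp
qed

text \<open>Whenever two images in the orbit of a periodic interval meet, merging the chain of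
  images generated by them yields a periodic interval with smaller period and the same orbit.\<close>

lemma ex_disjoint_cycle:
  assumes "compact J" "connected J" "J \<noteq> {}" "J \<subseteq> {0..1}" "0 < k" "(f ^^ k) ` J = J"
  shows "\<exists>J' p. disjoint_cycle f J' p \<and> orbit_set f J' = orbit_set f J"
  using assms
proof (induction k arbitrary: J rule: less_induct)
  case (less k)
  show ?case
  proof (cases "\<forall>i<k. \<forall>j<k. i \<noteq> j \<longrightarrow> (f ^^ i) ` J \<inter> (f ^^ j) ` J = {}")
    case True
    with less.prems have "disjoint_cycle f J k" by (simp add: disjoint_cycle_def)
    then show ?thesis by blast
  next
    case False
    then obtain i0 j0 where "i0 < k" "j0 < k" "i0 \<noteq> j0" "(f ^^ i0) ` J \<inter> (f ^^ j0) ` J \<noteq> {}"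
      by auto
    then have "\<exists>i j. i < j \<and> j < k \<and> (f ^^ i) ` J \<inter> (f ^^ j) ` J \<noteq> {}"
      by (cases "i0 < j0") (metis, metis Int_commute linorder_neqE_nat)
    then obtain i j where ij: "i < j" "j < k" "(f ^^ i) ` J \<inter> (f ^^ j) ` J \<noteq> {}"
      by (elim exE conjE)
    \<comment> \<open>Seen from the earlier of the two meeting images, \<open>J0\<close> overlaps
      its own image after \<open>d\<close> steps; \<open>d < k\<close> is the smaller period to
      which the induction hypothesis will apply.\<close>
    define d where "d = j - i"
    define J0 where "J0 = (f ^^ i) ` J"
    define A where "A r = (f ^^ (r * d)) ` J0" for r
    have d: "0 < d" "d < k" using ij by (auto simp: d_def)
    have J0k: "(f ^^ k) ` J0 = J0"
      unfolding J0_def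
      by (simp only: image_funpow_add[symmetric] add.commute[of k i]) (simp only: image_funpow_add less.prems(6))
    have J0: "compact J0" "connected J0" "J0 \<noteq> {}" "J0 \<subseteq> {0..1}"
      unfolding J0_def using less.prems funpow_compact funpow_connected funpow_maps by simp_all
    have "j = d + i" using ij by (simp add: d_def)
    then have meet: "J0 \<inter> (f ^^ d) ` J0 \<noteq> {}"
      using ij(3) by (simp add: J0_def image_funpow_add)
    have per: "A (r + k) = A r" for r
    proof -
      have "(r + k) * d = r * d + k * d" by (rule add_mult_distrib)
      then show ?thesis
        unfolding A_def by (simp only: image_funpow_add image_funpow_mult[OF J0k])
    qed
    define J' where "J' = (\<Union>r. A r)"
    \<comment> \<open>\<open>A\<close> repeats after \<open>k\<close> terms, because
      \<open>k * d\<close> steps return \<open>J0\<close> to itself; the union is therefore finite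
      and compactness survives.\<close>
    have fin: "J' = (\<Union>r<k. A r)"
    proof -
      have "A r = A (r mod k)" for r
      proof (induction r rule: less_induct)
        case (less r)
        show ?case
        proof (cases "r < k")
          case False
          then have "r - k < r" "r - k + k = r" using d by auto
          with less[of "r - k"] per[of "r - k"] show ?thesis by (simp add: le_mod_geq)
        qed simp
      qed
      moreover have "r mod k < k" for r using less.prems(5) by simp
      ultimately show ?thesis unfolding J'_def by blast
    qed
    have "compact J'"
      unfolding fin A_def using J0 funpow_compact by (intro compact_UN) auto
    moreover have "connected J'"
      unfolding J'_def
    proof (rule connected_UN_chain)
      show "connected (A n)" for n unfolding A_def using J0 funpow_connected by simp
      show "A n \<inter> A (Suc n) \<noteq> {}" for n
      proof -
        obtain z where z: "z \<in> J0" "z \<in> (f ^^ d) ` J0" using meet by blast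
        have "(f ^^ (n * d)) z \<in> A n" using z(1) by (simp add: A_def)
        moreover have "A (Suc n) = (f ^^ (n * d)) ` (f ^^ d) ` J0"
          by (simp only: A_def image_funpow_add[symmetric] mult_Suc add.commute)
        then have "(f ^^ (n * d)) z \<in> A (Suc n)" using z(2) by simp
        ultimately show ?thesis by blast
      qed
    qed
    moreover have "J' \<noteq> {}" "J' \<subseteq> {0..1}"
      unfolding J'_def A_def using J0 funpow_maps by blast+
    moreover have "(f ^^ d) ` J' = J'"
    proof -
      have AS: "(f ^^ d) ` A r = A (Suc r)" for r
        by (simp only: A_def image_funpow_add[symmetric] mult_Suc)
      then have "(f ^^ d) ` J' = (\<Union>r. A (Suc r))" by (simp add: J'_def image_UN)
      \<comment> \<open>Periodicity gives even \<open>A 0\<close> a predecessor, so that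
        \<open>J'\<close> is mapped onto itself and not merely into itself.\<close>
      moreover have "A r \<subseteq> (\<Union>r. A (Suc r))" for r
      proof -
        have "A r = A (Suc (r + k - 1))" using per[of r] d by simp
        then show ?thesis by blast
      qed
      moreover have "(\<Union>r. A (Suc r)) \<subseteq> J'" unfolding J'_def by (rule UN_least) (rule UN_upper, simp)
      ultimately show ?thesis unfolding J'_def by (intro equalityI UN_least) simp_all
    qed
    ultimately obtain J'' p where J'': "disjoint_cycle f J'' p" "orbit_set f J'' = orbit_set f J'"
      using less.IH[of d J'] d by blast
    have "orbit_set f J' = orbit_set f J0"
    proof
      show "orbit_set f J' \<subseteq> orbit_set f J0"
        unfolding orbit_set_def J'_def A_def image_UN image_funpow_add[symmetric] by blast
      have "J0 \<subseteq> J'" unfolding J'_def A_def by (rule UN_upper[of 0, THEN subset_trans[rotated]]) auto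
      then show "orbit_set f J0 \<subseteq> orbit_set f J'" unfolding orbit_set_def by blast
    qed
    also have "\<dots> = orbit_set f J"
      unfolding J0_def using less.prems(5,6) by (rule orbit_set_shift[rotated])
    finally show ?thesis using J'' by blast
  qed
qed

section \<open>Limit sets of intervals with two meeting images\<close>

text \<open>The images of \<open>V\<close> at times \<open>m + j * k\<close> form a chain of
  overlapping connected sets, so the closure \<open>N\<close> of their union is an interval mapped
  into itself by the iterate of order \<open>k\<close>. The intersection \<open>J\<close> of the
  forward images of \<open>N\<close> is mapped onto itself, and its orbit catches exactly the limit
  points of \<open>V\<close>. Images of \<open>J\<close> may still overlap, which
  \<open>ex_disjoint_cycle\<close> repairs.\<close>

lemma limit_set_eq_cycle:
  assumes V: "V \<subseteq> {0..1}" "connected V" and "0 < k"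
    and meet: "(f ^^ m) ` V \<inter> (f ^^ (m + k)) ` V \<noteq> {}"
  shows "\<exists>J p. disjoint_cycle f J p \<and> limit_set f V = orbit_set f J"
proof -
  define A where "A j = (f ^^ (m + j * k)) ` V" for j
  define L where "L = (\<Union>j. A j)"
  define N where "N = closure L"
  define C where "C j = (f ^^ (j * k)) ` N" for j
  have AS: "(f ^^ (i * k)) ` A j = A (i + j)" for i j
    by (simp add: A_def image_funpow_add[symmetric] algebra_simps)
  have A01: "A j \<subseteq> {0..1}" for j unfolding A_def using V funpow_maps by simp
  then have L01: "L \<subseteq> {0..1}" unfolding L_def by blast
  have N01: "N \<subseteq> {0..1}" unfolding N_def using L01 by (intro closure_minimal) auto
  have "connected L"
    unfolding L_def
  proof (rule connected_UN_chain)
    show "connected (A n)" for n unfolding A_def using V funpow_connected by simp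
    show "A n \<inter> A (Suc n) \<noteq> {}" for n
    proof -
      obtain z where "z \<in> A 0" "z \<in> A 1" using meet by (auto simp: A_def)
      then have "(f ^^ (n * k)) z \<in> A (n + 0)" "(f ^^ (n * k)) z \<in> A (n + 1)"
        unfolding AS[symmetric] by blast+
      then show ?thesis by auto
    qed
  qed
  then have "connected N" unfolding N_def by (rule connected_imp_connected_closure)
  have "bounded L" using bounded_closed_interval L01 by (rule bounded_subset)
  then have "compact N" unfolding N_def by simp
  have "L \<noteq> {}" using meet unfolding L_def A_def by blast
  then have "N \<noteq> {}" unfolding N_def by simp
  have image_N: "(f ^^ n) ` N \<subseteq> closure ((f ^^ n) ` L)" for n
  proof -
    have "continuous_on (closure L) (f ^^ n)"
      using continuous_on_subset[OF funpow_cont] N01 unfolding N_def by simp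
    then show ?thesis
      unfolding N_def by (rule image_closure_subset) (simp_all add: closure_subset)
  qed
  have "(f ^^ k) ` L \<subseteq> L"
    using AS[of 1] unfolding L_def by auto
  then have N_inv: "(f ^^ k) ` N \<subseteq> N"
    using image_N[of k] closure_mono unfolding N_def by blast
  have CS: "C (Suc j) = (f ^^ k) ` C j" for j
    by (simp only: C_def image_funpow_add[symmetric] mult_Suc)
  have CS': "C (Suc j) = (f ^^ (j * k)) ` (f ^^ k) ` N" for j
    by (simp only: C_def image_funpow_add[symmetric] mult_Suc add.commute)
  have "C (Suc j) \<subseteq> C j" for j
    unfolding CS' unfolding C_def using N_inv by (rule image_mono)
  then have C_dec: "C j \<subseteq> C i" if "i \<le> j" for i j
    using that by (rule lift_Suc_antimono_le)
  have C: "compact (C j)" "connected (C j)" "C j \<noteq> {}" "C j \<subseteq> {0..1}" for j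
    unfolding C_def using \<open>compact N\<close> \<open>connected N\<close> \<open>N \<noteq> {}\<close> N01 funpow_compact funpow_connected funpow_maps
    by simp_all
  define J where "J = (\<Inter>j. C j)"
  have J_image: "(f ^^ n) ` J = (\<Inter>j. (f ^^ n) ` C j)" for n
    unfolding J_def
    using C(1) C_dec continuous_on_subset[OF funpow_cont C(4)] by (rule image_INT_compact_decseq)
  have J_closed: "compact J" "connected J" "J \<noteq> {}" "J \<subseteq> {0..1}"
  proof -
    show "compact J" unfolding J_def using C(1) by (intro compact_Inter) auto
    show "connected J" unfolding J_def using C(1,2) C_dec by (rule connected_nest)
    show "J \<noteq> {}" unfolding J_def using C(1,3) C_dec by (rule compact_nest)
    show "J \<subseteq> {0..1}" unfolding J_def using C(4)[of 0] by blast
  qed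
  have J_per: "(f ^^ k) ` J = J"
  proof -
    have "(f ^^ k) ` J = (\<Inter>j. C (Suc j))" by (simp only: J_image CS)
    also have "\<dots> = J"
    proof
      have "C (Suc j) \<subseteq> C j" for j by (rule C_dec) simp
      then show "(\<Inter>j. C (Suc j)) \<subseteq> J" unfolding J_def by blast
      show "J \<subseteq> (\<Inter>j. C (Suc j))" unfolding J_def by (intro INT_greatest INT_lower) simp
    qed
    finally show ?thesis .
  qed
  have "limit_set f V = orbit_set f J"
  proof
    have "y \<in> (\<Union>i\<in>{..<k}. \<Inter>M. (f ^^ i) ` C M)" if y: "y \<in> limit_set f V" for y
    proof -
      have "y \<in> (\<Union>i\<in>{..<k}. (f ^^ i) ` C M)" for M
      proof -
        have "(\<Union>n\<in>{m + M * k..}. (f ^^ n) ` V) \<subseteq> (\<Union>i\<in>{..<k}. (f ^^ i) ` C M)"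
        proof (rule UN_least)
          fix n assume n: "n \<in> {m + M * k..}"
          \<comment> \<open>After the waiting time \<open>m + M * k\<close>, the quotient of
            \<open>q\<close> by \<open>k\<close> selects a member of the chain and the remainder
            selects one of the \<open>k\<close> images of \<open>C M\<close>.\<close>
          define q where "q = n - (m + M * k)"
          have "n = q mod k + (M * k + (m + (q div k) * k))"
            using n div_mult_mod_eq[of q k] unfolding q_def by (simp add: algebra_simps)
          then have "(f ^^ n) ` V = (f ^^ (q mod k)) ` (f ^^ (M * k)) ` A (q div k)"
            unfolding A_def by (simp only: image_funpow_add)
          also have "\<dots> \<subseteq> (f ^^ (q mod k)) ` C M"
            unfolding C_def N_def L_def by (intro image_mono) (meson UN_upper UNIV_I closure_subset order_trans)
          also have "\<dots> \<subseteq> (\<Union>i\<in>{..<k}. (f ^^ i) ` C M)"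
            using \<open>0 < k\<close> by (intro UN_upper) simp
          finally show "(f ^^ n) ` V \<subseteq> (\<Union>i\<in>{..<k}. (f ^^ i) ` C M)" .
        qed
        moreover have "closed (\<Union>i\<in>{..<k}. (f ^^ i) ` C M)"
          using funpow_compact[OF C(1,4)] by (intro closed_UN) (auto intro: compact_imp_closed)
        ultimately have "closure (\<Union>n\<in>{m + M * k..}. (f ^^ n) ` V) \<subseteq> (\<Union>i\<in>{..<k}. (f ^^ i) ` C M)"
          by (rule closure_minimal)
        then show ?thesis using y unfolding limit_set_def by blast
      qed
      then have "y \<in> (\<Inter>M. \<Union>i\<in>{..<k}. (f ^^ i) ` C M)" by blast
      \<comment> \<open>The index \<open>i\<close> found above may vary with \<open>M\<close>;
        finiteness of the index set and monotonicity in \<open>M\<close> yield a single index for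
        all \<open>M\<close>.\<close>
      moreover have "(\<Inter>M. \<Union>i\<in>{..<k}. (f ^^ i) ` C M) = (\<Union>i\<in>{..<k}. \<Inter>M. (f ^^ i) ` C M)"
        by (rule INT_finite_UN_decseq) (simp_all add: image_mono C_dec)
      ultimately show ?thesis by simp
    qed
    then show "limit_set f V \<subseteq> orbit_set f J"
      unfolding J_image[symmetric] orbit_set_def by blast
    show "orbit_set f J \<subseteq> limit_set f V"
      unfolding orbit_set_def limit_set_def
    proof (intro UN_least INT_greatest)
      fix n M
      \<comment> \<open>\<open>C M\<close> is the image of \<open>N\<close> after
        \<open>M * k \<ge> M\<close> steps, so continuity puts its further images into the closure
        of late images of \<open>V\<close>.\<close>
      have "(f ^^ n) ` J \<subseteq> (f ^^ n) ` C M" unfolding J_def by blast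
      also have "\<dots> = (f ^^ (n + M * k)) ` N" by (simp only: C_def image_funpow_add)
      also have "\<dots> \<subseteq> closure ((f ^^ (n + M * k)) ` L)" by (rule image_N)
      also have "\<dots> \<subseteq> closure (\<Union>n\<in>{M..}. (f ^^ n) ` V)"
      proof (rule closure_mono)
        have "M * 1 \<le> M * k" using \<open>0 < k\<close> by (intro mult_le_mono2) simp
        then have "M \<le> n + M * k + (m + j * k)" for j by linarith
        then show "(f ^^ (n + M * k)) ` L \<subseteq> (\<Union>n\<in>{M..}. (f ^^ n) ` V)"
          unfolding L_def A_def image_UN image_funpow_add[symmetric]
          by (intro UN_least UN_upper) simp
      qed
      finally show "(f ^^ n) ` J \<subseteq> closure (\<Union>n\<in>{M..}. (f ^^ n) ` V)" .
    qed
  qed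
  with ex_disjoint_cycle[OF J_closed \<open>0 < k\<close> J_per] show ?thesis by metis
qed

section \<open>Baire category and generic limit sets\<close>

text \<open>For a basic open set \<open>W\<close> and a time \<open>N\<close>, entering
  \<open>W\<close> at time \<open>N\<close> or later is a relatively open condition; together with
  the exterior of the set where it holds it gives an open dense set. A point in all these sets
  enters \<open>W\<close> late itself as soon as points arbitrarily near it do.\<close>

lemma residual_limit_set:
  "\<exists>G. G \<subseteq> {0..1} \<and> gdelta_in unit_space G \<and> unit_space closure_of G = {0..1} \<and>
     (\<forall>x\<in>G. (\<Inter>j. limit_set f (ball x (inverse (real (Suc j))) \<inter> {0..1})) \<subseteq> limit_set f {x})"
proof -
  obtain B :: "real set set" where B: "countable B" "topological_basis B"
    using ex_countable_basis by blast
  define O1 where "O1 W N = {0..1} \<inter> (\<Union>n\<in>{N..}. (f ^^ n) -` W)" for W N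
  define D where "D W N = O1 W N \<union> ({0..1} - closure (O1 W N))" for W N
  \<comment> \<open>The member \<open>{0..1}\<close> keeps the family visibly non-empty and its
    intersection inside the unit interval.\<close>
  define \<G> where "\<G> = (\<lambda>(W, N). D W N) ` (B \<times> UNIV) \<union> {{0..1}}"
  have D_open: "openin unit_space (D W N)" if "W \<in> B" for W N
  proof -
    have "open W" using B(2) that by (rule topological_basis_open)
    have "openin unit_space (\<Union>n\<in>{N..}. {0..1} \<inter> (f ^^ n) -` W)"
      using continuous_openin_preimage_gen[OF funpow_cont \<open>open W\<close>] by (intro openin_Union) auto
    moreover have "(\<Union>n\<in>{N..}. {0..1} \<inter> (f ^^ n) -` W) = O1 W N" unfolding O1_def by blast
    ultimately have "openin unit_space (O1 W N)" by (simp only:)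
    moreover have "openin unit_space ({0..1} - closure (O1 W N))"
      unfolding Diff_eq by (intro openin_open_Int open_Compl closed_closure)
    ultimately show ?thesis unfolding D_def by (rule openin_Un)
  qed
  have D_dense: "{0..1} \<subseteq> closure (D W N)" for W N
    using closure_subset[of "{0..1} - closure (O1 W N)"] unfolding D_def closure_Un by blast
  have \<G>: "openin unit_space T \<and> {0..1} \<subseteq> closure T" if "T \<in> \<G>" for T
    using that D_open subsetD[OF D_dense] unfolding \<G>_def by auto
  have "countable \<G>" unfolding \<G>_def using B(1) by simp
  have G01: "\<Inter>\<G> \<subseteq> {0..1}" unfolding \<G>_def by blast
  have "{0..1} \<subseteq> closure (\<Inter>\<G>)"
    using \<open>countable \<G>\<close> \<G> by (intro Baire) auto
  then have "unit_space closure_of (\<Inter>\<G>) = {0..1}"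
    using G01 by (simp add: closure_of_subtopology Int_absorb1 Int_absorb2)
  moreover have "gdelta_in unit_space (\<Inter>\<G>)"
    using \<open>countable \<G>\<close> \<G> by (intro gdelta_in_Inter open_imp_gdelta_in) (auto simp: \<G>_def)
  moreover have "y \<in> limit_set f {x}"
    if x: "x \<in> \<Inter>\<G>" and y: "\<And>j. y \<in> limit_set f (ball x (inverse (real (Suc j))) \<inter> {0..1})" for x y
    unfolding limit_set_def
  proof (rule INT_I)
    fix N
    show "y \<in> closure (\<Union>n\<in>{N..}. (f ^^ n) ` {x})"
      unfolding closure_iff_nhds_not_empty
    proof (intro allI impI)
      fix S T assume "T \<subseteq> S" "open T" "y \<in> T"
      then obtain W where W: "W \<in> B" "y \<in> W" "W \<subseteq> T"
        using B(2) by (metis topological_basisE)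
      then have "open W" using B(2) topological_basis_open by blast
      have "x \<in> D W N" using x W(1) unfolding \<G>_def by blast
      \<comment> \<open>Since \<open>y\<close> is a limit point for every ball about
        \<open>x\<close>, points entering \<open>W\<close> from time \<open>N\<close> on exist
        arbitrarily near \<open>x\<close>; this rules out the exterior branch of
        \<open>D W N\<close>.\<close>
      moreover have "x \<in> closure (O1 W N)"
      proof (rule ccontr)
        assume "x \<notin> closure (O1 W N)"
        then have "x \<in> - closure (O1 W N)" by simp
        then obtain e where e: "0 < e" "ball x e \<subseteq> - closure (O1 W N)"
          by (rule openE[OF open_Compl[OF closed_closure]])
        obtain j where "inverse (real (Suc j)) < e" using e(1) reals_Archimedean by blast
        then have "ball x (inverse (real (Suc j))) \<subseteq> ball x e" by (intro subset_ball) simp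
        then have "ball x (inverse (real (Suc j))) \<inter> O1 W N = {}"
          using e(2) closure_subset[of "O1 W N"] by blast
        then have "W \<inter> (\<Union>n\<in>{N..}. (f ^^ n) ` (ball x (inverse (real (Suc j))) \<inter> {0..1})) = {}"
          unfolding O1_def by blast
        moreover have "y \<in> closure (\<Union>n\<in>{N..}. (f ^^ n) ` (ball x (inverse (real (Suc j))) \<inter> {0..1}))"
          using y[of j] unfolding limit_set_def by blast
        ultimately show False
          using \<open>open W\<close> \<open>y \<in> W\<close> open_Int_closure_eq_empty by blast
      qed
      ultimately have "x \<in> O1 W N" unfolding D_def by blast
      then show "(\<Union>n\<in>{N..}. (f ^^ n) ` {x}) \<inter> S \<noteq> {}"
        using W(3) \<open>T \<subseteq> S\<close> unfolding O1_def by blast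
    qed
  qed
  ultimately have "\<Inter>\<G> \<subseteq> {0..1} \<and> gdelta_in unit_space (\<Inter>\<G>) \<and> unit_space closure_of (\<Inter>\<G>) = {0..1} \<and>
     (\<forall>x\<in>\<Inter>\<G>. (\<Inter>j. limit_set f (ball x (inverse (real (Suc j))) \<inter> {0..1})) \<subseteq> limit_set f {x})"
    using G01 by (intro conjI ballI subsetI[of "\<Inter>j. _ j"]) simp_all
  then show ?thesis by (rule exI)
qed

section \<open>Nested cycles of intervals\<close>

lemma compact_orbit_set:
  assumes "disjoint_cycle f J p"
  shows "compact (orbit_set f J)"
  unfolding disjoint_cycle_orbit_set[OF assms]
  by (intro compact_UN funpow_compact disjoint_cycleD[OF assms]) simp

lemma orbit_set_subset_unit: "J \<subseteq> {0..1} \<Longrightarrow> orbit_set f J \<subseteq> {0..1}"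
  unfolding orbit_set_def by (intro UN_least funpow_maps)

text \<open>The cycle consists of finitely many disjoint closed sets, so a connected subset of their
  union cannot touch two of them.\<close>

lemma connected_subset_image_cycle:
  assumes J: "disjoint_cycle f J p" and S: "connected S" "S \<subseteq> orbit_set f J"
    and meet: "S \<inter> (f ^^ n) ` J \<noteq> {}"
  shows "S \<subseteq> (f ^^ n) ` J"
proof -
  define K where "K = (f ^^ n) ` J"
  have K: "disjoint_cycle f K p"
    unfolding K_def by (rule disjoint_cycle_shift[OF J])
  note K' = disjoint_cycleD[OF K]
  \<comment> \<open>The cycle is restarted at \<open>K\<close>, the component that \<open>S\<close>
    meets; \<open>R\<close> collects the others, hence the index starts at 1.\<close>
  define R where "R = (\<Union>i\<in>{1..<p}. (f ^^ i) ` K)"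
  have "closed R"
    unfolding R_def
    by (intro closed_UN ballI compact_imp_closed funpow_compact K') simp
  have "closed K" using K'(1) by (rule compact_imp_closed)
  have "orbit_set f K = orbit_set f J"
    unfolding K_def using disjoint_cycleD(6,5)[OF J] by (rule orbit_set_shift)
  moreover have "orbit_set f K \<subseteq> K \<union> R"
    unfolding disjoint_cycle_orbit_set[OF K]
  proof (rule UN_least)
    fix i assume "i \<in> {..<p}"
    show "(f ^^ i) ` K \<subseteq> K \<union> R"
    proof (cases "i = 0")
      case False
      then have "(f ^^ i) ` K \<subseteq> R" unfolding R_def using \<open>i \<in> {..<p}\<close> by (intro UN_upper) simp
      then show ?thesis by (rule le_supI2)
    qed simp
  qed
  ultimately have SKR: "S \<subseteq> K \<union> R" using S(2) by simp
  have "K \<inter> (f ^^ i) ` K = {}" if "i \<in> {1..<p}" for i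
  proof -
    have "\<not> (f ^^ 0) ` K \<inter> (f ^^ i) ` K \<noteq> {}"
      unfolding disjoint_cycle_meet_iff[OF K] using that by simp
    then show ?thesis by simp
  qed
  then have "K \<inter> R = {}" unfolding R_def by (simp add: Int_UN_distrib)
  then have "K \<inter> S = {} \<or> R \<inter> S = {}"
    using connected_closedD[OF S(1) _ SKR \<open>closed K\<close> \<open>closed R\<close>] by simp
  with meet have "R \<inter> S = {}" unfolding K_def by (simp add: Int_commute)
  with SKR show ?thesis unfolding K_def by (auto simp: disjoint_iff)
qed

text \<open>Connectedness confines \<open>J'\<close> to the one component that it meets. After
  \<open>p'\<close> steps \<open>J'\<close> is back in place, so the component \<open>J\<close>
  meets its image at that time, which happens only at multiples of \<open>p\<close>.\<close>

lemma disjoint_cycle_nested: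
  assumes J: "disjoint_cycle f J p" and J': "disjoint_cycle f J' p'"
    and sub: "orbit_set f J' \<subseteq> orbit_set f J" and meet: "J \<inter> J' \<noteq> {}"
  shows "J' \<subseteq> J" "p dvd p'"
proof -
  have "J' \<subseteq> orbit_set f J'" unfolding orbit_set_def using UN_upper[of 0 UNIV "\<lambda>n. (f ^^ n) ` J'"] by simp
  then have "J' \<subseteq> (f ^^ 0) ` J"
    using sub meet by (intro connected_subset_image_cycle[OF J disjoint_cycleD(2)[OF J']]) (simp_all add: Int_commute)
  then show "J' \<subseteq> J" by simp
  then have "(f ^^ p') ` J' \<subseteq> (f ^^ p') ` J" by (rule image_mono)
  with \<open>J' \<subseteq> J\<close> have "J' \<subseteq> (f ^^ p') ` J \<inter> (f ^^ 0) ` J"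
    by (simp add: disjoint_cycleD(6)[OF J'])
  with disjoint_cycleD(3)[OF J'] have "(f ^^ p') ` J \<inter> (f ^^ 0) ` J \<noteq> {}" by blast
  then show "p dvd p'" unfolding disjoint_cycle_meet_iff[OF J] by (simp add: dvd_eq_mod_eq_0)
qed

text \<open>The orbit of a cycle of intervals is closed and forward invariant.\<close>

lemma limit_set_subset_orbit_set:
  assumes J: "disjoint_cycle f J p" and z: "z \<in> orbit_set f J"
  shows "limit_set f {z} \<subseteq> orbit_set f J"
proof -
  obtain m where m: "z \<in> (f ^^ m) ` J" using z unfolding orbit_set_def by blast
  have "(f ^^ n) z \<in> orbit_set f J" for n
  proof -
    have "(f ^^ n) z \<in> (f ^^ (n + m)) ` J" using m unfolding image_funpow_add by (rule imageI)
    then show ?thesis unfolding orbit_set_def by (rule UN_I[rotated]) simp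
  qed
  then have "closure (\<Union>n\<in>{0..}. (f ^^ n) ` {z}) \<subseteq> orbit_set f J"
    by (intro closure_minimal compact_imp_closed[OF compact_orbit_set[OF J]] UN_least) simp
  then show ?thesis unfolding limit_set_def by (rule subset_trans[OF INT_lower, rotated]) simp
qed

text \<open>The tails of the orbit have nested, non-empty, compact closures.\<close>

lemma limit_set_nonempty:
  assumes "x \<in> {0..1}"
  shows "limit_set f {x} \<noteq> {}"
  unfolding limit_set_def
proof (rule compact_nest)
  fix N
  have "(\<Union>n\<in>{N..}. (f ^^ n) ` {x}) \<subseteq> {0..1}"
    using assms by (intro UN_least funpow_maps) simp
  then show "compact (closure (\<Union>n\<in>{N..}. (f ^^ n) ` {x}))"
    by (simp add: bounded_subset[OF bounded_closed_interval])
  show "closure (\<Union>n\<in>{N..}. (f ^^ n) ` {x}) \<noteq> {}" by auto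
qed (rule closure_mono, rule UN_atLeast_subset_mono)

text \<open>For given times \<open>m < n\<close>, a cycle of period above \<open>n\<close> holds
  \<open>I\<close> inside one component, and the images of that component at the two times are
  disjoint. A cycle of points attracting \<open>I\<close> would lie in all the cycles of intervals,
  which is incompatible with their unbounded periods.\<close>

lemma wandering_interval_of_unbounded_periods:
  assumes J: "\<And>j. disjoint_cycle f (J j) (p j)" and p: "\<And>b. \<exists>j. b < p j"
    and I: "I \<subseteq> {0..1}" "is_interval I" "a \<in> I" "b \<in> I" "a < b"
    and sub: "\<And>j. I \<subseteq> orbit_set f (J j)"
  shows "wandering_interval f I"
proof -
  have ex: "\<exists>i. I \<subseteq> (f ^^ i) ` J j" for j
  proof -
    obtain i where "a \<in> (f ^^ i) ` J j" using sub[of j] I(3) unfolding orbit_set_def by blast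
    then have "I \<subseteq> (f ^^ i) ` J j"
      using I(2,3) sub[of j]
      by (intro connected_subset_image_cycle[OF J]) (auto simp: is_interval_connected)
    then show ?thesis ..
  qed
  have "(f ^^ n) ` I \<inter> (f ^^ m) ` I = {}" if "m < n" for m n
  proof -
    obtain j where j: "n < p j" using p by blast
    obtain i where i: "I \<subseteq> (f ^^ i) ` J j" using ex by blast
    have "(n + i) mod p j \<noteq> (m + i) mod p j"
    proof
      assume "(n + i) mod p j = (m + i) mod p j"
      then have "p j dvd (n + i) - (m + i)" by (metis mod_eq_dvd_iff_nat add_le_cancel_right less_imp_le_nat that)
      then show False using that j by (auto dest: dvd_imp_le)
    qed
    then have "\<not> (f ^^ (n + i)) ` J j \<inter> (f ^^ (m + i)) ` J j \<noteq> {}"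
      unfolding disjoint_cycle_meet_iff[OF J] .
    moreover have "(f ^^ n) ` I \<subseteq> (f ^^ (n + i)) ` J j" "(f ^^ m) ` I \<subseteq> (f ^^ (m + i)) ` J j"
      unfolding image_funpow_add using i by (auto intro: image_mono)
    ultimately show ?thesis by blast
  qed
  moreover have "\<not> tends_to_cycle f I"
  proof
    assume "tends_to_cycle f I"
    then obtain C where "point_cycle f C" "omega_limit f a = C"
      using I(3) unfolding tends_to_cycle_def by blast
    then obtain q k where q: "0 < k" "(f ^^ k) q = q" "omega_limit f a = range (\<lambda>n. (f ^^ n) q)"
      unfolding point_cycle_def by auto
    \<comment> \<open>A cycle with more than \<open>k\<close> components cannot contain a point
      fixed by the iterate of order \<open>k\<close>, as the point would be back in its component
      too early.\<close>
    obtain j where j: "k < p j" using p by blast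
    have "(f ^^ 0) q \<in> omega_limit f a" unfolding q(3) by (rule rangeI)
    then have "q \<in> orbit_set f (J j)"
      using limit_set_subset_orbit_set[OF J[of j], of a] sub[of j] I(3)
      unfolding omega_limit_eq_limit_set by auto
    then obtain i where i: "q \<in> (f ^^ i) ` J j" unfolding orbit_set_def by blast
    then have "(f ^^ k) q \<in> (f ^^ (k + i)) ` J j" unfolding image_funpow_add by (rule imageI)
    with i q(2) have "(f ^^ (k + i)) ` J j \<inter> (f ^^ (0 + i)) ` J j \<noteq> {}" by auto
    then have "(k + i) mod p j = (0 + i) mod p j"
      unfolding disjoint_cycle_meet_iff[OF J] .
    then have "p j dvd (k + i) - (0 + i)" by (metis mod_eq_dvd_iff_nat add_le_cancel_right zero_le)
    then show False using q(1) j by (auto dest: dvd_imp_le)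
  qed
  ultimately show ?thesis unfolding wandering_interval_def using I by blast
qed

text \<open>Nested cycles of intervals: if the periods stabilise, the intersection is again a cycle
  of (possibly degenerate) intervals; otherwise it contains no interval, since such an
  interval would wander.\<close>

lemma Inter_nested_cycles:
  assumes J: "\<And>j. disjoint_cycle f (J j) (p j)" and y: "\<And>j. y \<in> J j"
    and dec: "\<And>j. orbit_set f (J (Suc j)) \<subseteq> orbit_set f (J j)"
    and nowand: "\<not> (\<exists>I. wandering_interval f I)"
  defines "Q \<equiv> \<Inter>j. orbit_set f (J j)"
  shows "point_cycle f Q \<or> solenoid f Q \<or> cycle_of_intervals f Q"
proof -
  have orb_dec: "orbit_set f (J j) \<subseteq> orbit_set f (J i)" if "i \<le> j" for i j
    using dec that by (rule lift_Suc_antimono_le)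
  have "J i \<inter> J j \<noteq> {}" for i j using y by blast
  note nested = disjoint_cycle_nested[OF J J orb_dec this]
  have J_dec: "J j \<subseteq> J i" and p_dvd: "p i dvd p j" if "i \<le> j" for i j
    using nested[OF that] by simp_all
  have p_pos: "0 < p j" for j using disjoint_cycleD(5)[OF J] .
  have p_mono: "p i \<le> p j" if "i \<le> j" for i j
    using p_dvd[OF that] p_pos by (rule dvd_imp_le)
  show ?thesis
  proof (cases "\<exists>b. \<forall>j. p j \<le> b")
    case True
    then have fin: "finite (range p)" by (auto simp: finite_nat_set_iff_bounded_le)
    then have "Max (range p) \<in> range p" by (intro Max_in) simp_all
    then obtain j0 where j0: "p j0 = Max (range p)" by (metis imageE)
    \<comment> \<open>Periods grow along the sequence, so they are frozen once the maximum is
      attained.\<close>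
    have p_const: "p (j + j0) = p j0" for j
      using p_mono[of j0 "j + j0"] Max_ge[OF fin, of "p (j + j0)"] j0 by simp
    define K where "K j = J (j + j0)" for j
    define q where "q = p j0"
    have K: "disjoint_cycle f (K j) q" for j
      using J[of "j + j0"] unfolding K_def q_def p_const .
    have K_dec: "K j \<subseteq> K i" if "i \<le> j" for i j unfolding K_def using that by (intro J_dec) simp
    define L where "L = (\<Inter>j. K j)"
    have L_image: "(f ^^ n) ` L = (\<Inter>j. (f ^^ n) ` K j)" for n
      unfolding L_def
      by (rule image_INT_compact_decseq)
        (use disjoint_cycleD[OF K] K_dec continuous_on_subset[OF funpow_cont] in auto)
    have "y \<in> L" unfolding L_def K_def using y by blast
    have L: "disjoint_cycle f L q"
      unfolding disjoint_cycle_def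
    proof (intro conjI allI impI)
      show "compact L" unfolding L_def using disjoint_cycleD(1)[OF K] by (intro compact_Inter) auto
      show "connected L" unfolding L_def using disjoint_cycleD(1,2)[OF K] K_dec by (rule connected_nest)
      show "L \<noteq> {}" using \<open>y \<in> L\<close> by blast
      show "L \<subseteq> {0..1}" unfolding L_def using disjoint_cycleD(4)[OF K] by blast
      show "0 < q" unfolding q_def by (rule p_pos)
      show "(f ^^ q) ` L = L" unfolding L_image disjoint_cycleD(6)[OF K] by (simp add: L_def)
      fix i j assume "i < q" "j < q" "i \<noteq> j"
      then have "\<not> (f ^^ i) ` K 0 \<inter> (f ^^ j) ` K 0 \<noteq> {}"
        unfolding disjoint_cycle_meet_iff[OF K] by simp
      then show "(f ^^ i) ` L \<inter> (f ^^ j) ` L = {}" unfolding L_image by blast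
    qed
    \<comment> \<open>With the number \<open>q\<close> of components fixed, the decreasing
      intersection commutes with the finite union over components.\<close>
    have "orbit_set f L = (\<Inter>j. \<Union>i\<in>{..<q}. (f ^^ i) ` K j)"
      unfolding disjoint_cycle_orbit_set[OF L] L_image
      by (rule INT_finite_UN_decseq[symmetric]) (simp_all add: image_mono K_dec)
    also have "\<dots> = (\<Inter>j. orbit_set f (K j))"
      by (simp add: disjoint_cycle_orbit_set[OF K])
    also have "\<dots> = Q"
    proof
      have "orbit_set f (K j) \<subseteq> orbit_set f (J j)" for j unfolding K_def by (rule orb_dec) simp
      then show "(\<Inter>j. orbit_set f (K j)) \<subseteq> Q" unfolding Q_def by blast
      show "Q \<subseteq> (\<Inter>j. orbit_set f (K j))" unfolding Q_def K_def by blast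
    qed
    finally have Q: "Q = orbit_set f L" ..
    show ?thesis
    proof (cases "\<exists>z. L = {z}")
      case True
      then obtain z where z: "L = {z}" ..
      have "Q = range (\<lambda>n. (f ^^ n) z)" unfolding Q z orbit_set_def by auto
      moreover have "z \<in> {0..1}" "(f ^^ q) z = z" "0 < q"
        using disjoint_cycleD(4-6)[OF L] unfolding z by simp_all
      ultimately show ?thesis unfolding point_cycle_def by blast
    next
      case False
      then have "periodic_interval f L q" using L by (intro disjoint_cycle_nondegenerate) simp_all
      moreover have "Q = interval_orbit f L q" by (simp add: Q disjoint_cycle_interval_orbit[OF L])
      ultimately show ?thesis unfolding cycle_of_intervals_def by blast
    qed
  next
    case False
    then have unb: "\<exists>j. b < p j" for b by (simp add: not_le)
    have p_top: "filterlim p at_top sequentially"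
      unfolding filterlim_at_top
    proof
      fix Z
      obtain j where "Z < p j" using unb by blast
      then have "Z \<le> p n" if "j \<le> n" for n using p_mono[OF that] by simp
      then show "\<forall>\<^sub>F n in sequentially. Z \<le> p n" by (rule eventually_sequentiallyI)
    qed
    have per: "periodic_interval f (J j) (p j)" for j
    proof (rule disjoint_cycle_nondegenerate[OF J], rule notI)
      assume "\<exists>z. J j = {z}"
      then obtain z where z: "J j = {z}" ..
      \<comment> \<open>A single point cannot shrink further: every later \<open>J i\<close> equals
        \<open>J j\<close>, so \<open>p j\<close> is a return time of \<open>J i\<close> and a
        multiple of \<open>p i\<close>. All periods would then be bounded by
        \<open>p j\<close>.\<close>
      have "p i \<le> p j" for i
      proof (cases "j \<le> i")
        case True
        then have "J i = J j" using J_dec[OF True] disjoint_cycleD(3)[OF J, of i] unfolding z by blast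
        then have "(f ^^ p j) ` J i \<inter> (f ^^ 0) ` J i \<noteq> {}"
          using disjoint_cycleD(3,6)[OF J, of j] by simp
        then have "p i dvd p j"
          unfolding disjoint_cycle_meet_iff[OF J] by (simp add: dvd_eq_mod_eq_0)
        then show ?thesis using p_pos by (rule dvd_imp_le)
      qed (use p_mono in simp)
      with unb[of "p j"] show False by (simp add: not_le[symmetric])
    qed
    have Q01: "Q \<subseteq> {0..1}"
      unfolding Q_def using orbit_set_subset_unit[OF disjoint_cycleD(4)[OF J]] by blast
    have "closed Q"
      unfolding Q_def using compact_imp_closed[OF compact_orbit_set[OF J]] by (intro closed_INT) simp
    have "unit_space interior_of Q = {}"
    proof (rule ccontr)
      assume "unit_space interior_of Q \<noteq> {}"
      then obtain z where z: "z \<in> unit_space interior_of Q" by blast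
      have "openin unit_space (unit_space interior_of Q)" by (rule openin_interior_of)
      then obtain T where T: "open T" "unit_space interior_of Q = {0..1} \<inter> T"
        unfolding openin_open by blast
      have TQ: "{0..1} \<inter> T \<subseteq> Q" unfolding T(2)[symmetric] by (rule interior_of_subset)
      have "z \<in> T" "z \<in> {0..1}" using z T(2) by simp_all
      then obtain e where e: "0 < e" "ball z e \<subseteq> T" using T(1) openE by blast
      \<comment> \<open>Half the radius keeps the closed interval inside the ball, and clipping to
        the unit interval leaves it non-degenerate because \<open>z\<close> lies there.\<close>
      define c d where "c = max 0 (z - e / 2)" and "d = min 1 (z + e / 2)"
      have cd: "0 \<le> c" "c < d" "d \<le> 1" "z - e < c" "d < z + e"
        using e(1) \<open>z \<in> {0..1}\<close> unfolding c_def d_def by auto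
      have "{c..d} \<subseteq> {0..1} \<inter> T"
      proof
        fix w assume w: "w \<in> {c..d}"
        then have "w \<in> ball z e" using cd by (auto simp: dist_real_def)
        with e(2) w cd show "w \<in> {0..1} \<inter> T" by auto
      qed
      with TQ have cdQ: "{c..d} \<subseteq> Q" by blast
      have "wandering_interval f {c..d}"
      proof (rule wandering_interval_of_unbounded_periods[OF J unb])
        show "{c..d} \<subseteq> orbit_set f (J j)" for j using cdQ unfolding Q_def by blast
      qed (use cd in \<open>auto simp: is_interval_cc\<close>)
      with nowand show False by blast
    qed
    moreover have "unit_space closure_of Q = Q"
      using \<open>closed Q\<close> Q01 by (simp add: closure_of_subtopology Int_absorb1)
    ultimately have "nowhere_dense_in unit_space Q"
      using Q01 by (simp add: nowhere_dense_in_def)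
    moreover have "Q = (\<Inter>j. interval_orbit f (J j) (p j))"
      unfolding Q_def by (simp add: disjoint_cycle_interval_orbit[OF J])
    moreover have "J (Suc j) \<subseteq> J j" for j by (rule J_dec) simp
    ultimately have "solenoid f Q"
      unfolding solenoid_def using per p_top by (intro exI[of _ J] exI[of _ p] conjI allI)
    then show ?thesis by blast
  qed
qed

section \<open>Classification of the generic limit sets\<close>

text \<open>By monotonicity and \<open>gen\<close>, the omega-limit set is the intersection of the
  limit sets of the shrinking neighbourhoods \<open>V j\<close>. One neighbourhood with disjoint
  images already settles the case of a cycle; otherwise every \<open>V j\<close> contributes a cycle
  of intervals and \<open>Inter_nested_cycles\<close> decides.\<close>

lemma omega_limit_trichotomy:
  assumes nowand: "\<not> (\<exists>I. wandering_interval f I)" and x: "x \<in> {0..1}"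
    and gen: "(\<Inter>j. limit_set f (ball x (inverse (real (Suc j))) \<inter> {0..1})) \<subseteq> limit_set f {x}"
  shows "point_cycle f (omega_limit f x) \<or> solenoid f (omega_limit f x) \<or>
    cycle_of_intervals f (omega_limit f x)"
proof -
  define V where "V j = ball x (inverse (real (Suc j))) \<inter> {0..1}" for j
  have xV: "x \<in> V j" for j unfolding V_def using x by simp
  have V: "V j \<subseteq> {0..1}" "is_interval (V j)" for j
    unfolding V_def by (auto simp: is_interval_convex_1 intro: convex_Int)
  have omega: "omega_limit f x = (\<Inter>j. limit_set f (V j))"
  proof
    have "limit_set f {x} \<subseteq> limit_set f (V j)" for j using xV by (intro limit_set_mono) simp
    then show "omega_limit f x \<subseteq> (\<Inter>j. limit_set f (V j))"
      unfolding omega_limit_eq_limit_set by (rule INT_greatest)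
    show "(\<Inter>j. limit_set f (V j)) \<subseteq> omega_limit f x"
      using gen unfolding omega_limit_eq_limit_set V_def .
  qed
  show ?thesis
  proof (cases "\<exists>j. \<forall>n m. m < n \<longrightarrow> (f ^^ n) ` V j \<inter> (f ^^ m) ` V j = {}")
    case True
    then obtain j where j: "\<forall>n m. m < n \<longrightarrow> (f ^^ n) ` V j \<inter> (f ^^ m) ` V j = {}" ..
    \<comment> \<open>Points at distance \<open>e\<close> on either side of \<open>x\<close>,
      clipped to the unit interval, show that \<open>V j\<close> is non-degenerate, also when
      \<open>x\<close> is an endpoint.\<close>
    define e where "e = inverse (real (Suc j)) / 2"
    have "0 < e" "e < inverse (real (Suc j))" unfolding e_def by (simp_all del: of_nat_Suc)
    then have "max 0 (x - e) \<in> V j" "min 1 (x + e) \<in> V j" "max 0 (x - e) < min 1 (x + e)"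
      using x unfolding V_def by (auto simp: dist_real_def simp del: of_nat_Suc)
    with nowand j V[of j] have "tends_to_cycle f (V j)"
      unfolding wandering_interval_def by blast
    then obtain C where "point_cycle f C" "\<forall>z\<in>V j. omega_limit f z = C"
      unfolding tends_to_cycle_def by (elim exE conjE)
    then have "point_cycle f (omega_limit f x)" using xV[of j] by simp
    then show ?thesis ..
  next
    case False
    then have ret: "\<exists>n m. m < n \<and> (f ^^ n) ` V j \<inter> (f ^^ m) ` V j \<noteq> {}" for j
      by simp
    have "\<exists>J p. disjoint_cycle f J p \<and> limit_set f (V j) = orbit_set f J" for j
    proof -
      obtain n m where "m < n" "(f ^^ n) ` V j \<inter> (f ^^ m) ` V j \<noteq> {}"
        using ret[of j] by (elim exE conjE)
      then show ?thesis
        using limit_set_eq_cycle[OF V(1), of j "n - m" m] V(2)[of j]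
        by (simp add: is_interval_connected Int_commute)
    qed
    then obtain J p where J: "\<And>j. disjoint_cycle f (J j) (p j)"
      "\<And>j. limit_set f (V j) = orbit_set f (J j)" by metis
    \<comment> \<open>The orbits are nested, but the representatives \<open>J j\<close> were chosen
      independently; one common limit point \<open>y\<close> picks a matching component from each
      cycle.\<close>
    obtain y where y: "y \<in> omega_limit f x"
      using limit_set_nonempty[OF x] unfolding omega_limit_eq_limit_set by blast
    have "\<exists>i. y \<in> (f ^^ i) ` J j" for j
      using y unfolding omega J(2) orbit_set_def by blast
    then obtain i where i: "\<And>j. y \<in> (f ^^ i j) ` J j" by metis
    define K where "K j = (f ^^ i j) ` J j" for j
    have K: "disjoint_cycle f (K j) (p j)" for j
      unfolding K_def by (rule disjoint_cycle_shift[OF J(1)])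
    have orb: "orbit_set f (K j) = limit_set f (V j)" for j
      unfolding K_def J(2) using disjoint_cycleD(6,5)[OF J(1)] by (rule orbit_set_shift)
    have "orbit_set f (K (Suc j)) \<subseteq> orbit_set f (K j)" for j
      unfolding orb V_def by (intro limit_set_mono Int_mono subset_ball) (simp_all add: field_simps)
    then have "point_cycle f (\<Inter>j. orbit_set f (K j)) \<or> solenoid f (\<Inter>j. orbit_set f (K j)) \<or>
      cycle_of_intervals f (\<Inter>j. orbit_set f (K j))"
      using K i nowand unfolding K_def by (intro Inter_nested_cycles)
    then show ?thesis unfolding omega orb .
  qed
qed

end

theorem theorem6p2:
  fixes f :: "real \<Rightarrow> real"
  assumes "continuous_on {0..1} f"
    and "f ` {0..1} \<subseteq> {0..1}"
    and "\<not> (\<exists>I. wandering_interval f I)"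
  shows "\<exists>G. residual_in unit_space G \<and>
    (\<forall>x\<in>G. point_cycle f (omega_limit f x) \<or>
            solenoid f (omega_limit f x) \<or>
            cycle_of_intervals f (omega_limit f x))"
proof -
  obtain G where G: "G \<subseteq> {0..1}" "gdelta_in unit_space G" "unit_space closure_of G = {0..1}"
    "\<forall>x\<in>G. (\<Inter>j. limit_set f (ball x (inverse (real (Suc j))) \<inter> {0..1})) \<subseteq> limit_set f {x}"
    using residual_limit_set[OF assms(1,2)] by blast
  then have "residual_in unit_space G" unfolding residual_in_def by auto
  moreover have "point_cycle f (omega_limit f x) \<or> solenoid f (omega_limit f x) \<or>
      cycle_of_intervals f (omega_limit f x)" if "x \<in> G" for x
    using omega_limit_trichotomy[OF assms] G that by blast
  ultimately show ?thesis by blast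
qed

end
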